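(* Let $n\ge1$ be an integer and $q\in\mathbb{C}$, $0<|q|<1$ (fix a choice of $q^{1/2}$). Then for $\delta\in\{0,1\}$, $$2\,q^{\binom n2(1-n-3\delta/2)}\det_{1\le i,j\le n}\left(\pi_{\delta+i-j}(q)\right)=\det_{1\le i,j\le n}\left(q^{(j-1)(n-i+\delta/2)}\theta(q^{4n+2\delta+1-4i+j};q^5)+q^{-(j-1)(n-i+\delta/2)}\theta(q^{4n+2\delta+3-4i-j};q^5)\right),$$ and $$(-1)^{n}q^{-n(2n^2+3n-3)/4}\det_{1\le i,j\le n}\left(\pi_{2+i-j}(q)\right)=\det_{1\le i,j\le n}\left(q^{(j-1/2)(n-i+1)}\theta(q^{6+4n-4i+j};q^5)-q^{-(j-1/2)(n-i+1)}\theta(q^{7+4n-4i-j};q^5)\right).$$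
   Context: $(a;q)_\infty=\prod_{i\ge0}(1-aq^i)$, $\theta(z;q)=(z;q)_\infty(q/z;q)_\infty$. The Schur polynomials $D_k(q),E_k(q)$, $k\in\mathbb{Z}$, are defined by $D_k=D_{k-1}+q^kD_{k-2}$, $D_0=1$, $D_1=1+q$, and $E_k=E_{k-1}+q^kE_{k-2}$, $E_0=1$, $E_1=1$, the recursions being used in both directions to define them for all integers $k$. For $k\in\mathbb{Z}$, $$\pi_k(q)=(-1)^kq^{-\binom k2}\theta(q^2;q^5)E_{k-2}(q)-(-1)^kq^{-\binom k2}\theta(q;q^5)D_{k-2}(q),\qquad \binom k2=\frac{k(k-1)}2.$$ *)

theory Defs
  imports "HOL-Analysis.Infinite_Products" "Jordan_Normal_Form.Determinant"
begin

definition qpoch_inf :: "complex \<Rightarrow> complex \<Rightarrow> complex" where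
  "qpoch_inf a q = (\<Prod>i. 1 - a * q ^ i)"

definition qtheta :: "complex \<Rightarrow> complex \<Rightarrow> complex" where
  "qtheta z q = qpoch_inf z q * qpoch_inf (q / z) q"

lemma qpoch_inf_has_prod:
  assumes "norm q < 1"
  shows "(\<lambda>i. 1 - a * q ^ i) has_prod qpoch_inf a q"
proof -
  have "summable (\<lambda>i. norm ((1 - a * q ^ i) - 1))"
    using assms by (simp add: norm_mult norm_power summable_mult summable_geometric)
  then have "convergent_prod (\<lambda>i. 1 - a * q ^ i)"
    by (intro abs_convergent_prod_imp_convergent_prod summable_imp_abs_convergent_prod)
  then show ?thesis
    unfolding qpoch_inf_def by (rule convergent_prod_has_prod)
qed

text \<open>The two-sided solution of \<open>X k = X (k - 1) + q powi k * X (k - 2)\<close> with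
  \<open>X 0 = c0\<close> and \<open>X 1 = c1\<close>; the last branch is this recursion at \<open>k + 2\<close>, solved for \<open>X k\<close>.\<close>

function schur_rec :: "complex \<Rightarrow> complex \<Rightarrow> complex \<Rightarrow> int \<Rightarrow> complex" where
  "schur_rec c0 c1 q k =
     (if k = 0 then c0
      else if k = 1 then c1
      else if k \<ge> 2 then schur_rec c0 c1 q (k - 1) + q powi k * schur_rec c0 c1 q (k - 2)
      else (schur_rec c0 c1 q (k + 2) - schur_rec c0 c1 q (k + 1)) / q powi (k + 2))"
  by pat_completeness auto
termination
  by (relation "Wellfounded.measure (\<lambda>(_, _, _, k). nat \<bar>2 * k - 1\<bar>)") auto

declare schur_rec.simps [simp del]

definition schur_D :: "complex \<Rightarrow> int \<Rightarrow> complex" where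
  "schur_D q k = schur_rec 1 (1 + q) q k"

definition schur_E :: "complex \<Rightarrow> int \<Rightarrow> complex" where
  "schur_E q k = schur_rec 1 1 q k"

lemma schur_rec_0: "schur_rec c0 c1 q 0 = c0"
  by (simp add: schur_rec.simps)

lemma schur_rec_1: "schur_rec c0 c1 q 1 = c1"
  by (simp add: schur_rec.simps)

lemma schur_rec_step:
  assumes "q \<noteq> 0"
  shows "schur_rec c0 c1 q k = schur_rec c0 c1 q (k - 1) + q powi k * schur_rec c0 c1 q (k - 2)"
proof (cases "k \<ge> 2")
  case True
  then show ?thesis
    by (subst schur_rec.simps) simp
next
  case False
  then have "schur_rec c0 c1 q (k - 2) = (schur_rec c0 c1 q k - schur_rec c0 c1 q (k - 1)) / q powi k"
    by (subst schur_rec.simps) (simp add: algebra_simps)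
  then show ?thesis
    using assms by simp
qed

text \<open>The product \<open>k * (k - 1)\<close> is even, so the division is exact.\<close>

definition binom2 :: "int \<Rightarrow> int" where
  "binom2 k = k * (k - 1) div 2"

definition schur_pi :: "complex \<Rightarrow> int \<Rightarrow> complex" where
  "schur_pi q k =
     (-1) powi k * q powi (- binom2 k) * qtheta (q ^ 2) (q ^ 5) * schur_E q (k - 2)
     - (-1) powi k * q powi (- binom2 k) * qtheta q (q ^ 5) * schur_D q (k - 2)"

text \<open>The determinant of \<open>f i j\<close> over \<open>1 \<le> i, j \<le> n\<close>; matrices in the library are indexed from 0.\<close>

definition det_upto :: "nat \<Rightarrow> (int \<Rightarrow> int \<Rightarrow> complex) \<Rightarrow> complex" where
  "det_upto n f = Determinant.det (mat n n (\<lambda>(i, j). f (int i + 1) (int j + 1)))"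

text \<open>Half-integral powers of \<open>q\<close> are written as powers of a fixed square root \<open>s\<close>, with
  doubled exponent. The following makes the exponent \<open>- n * (2 * n\<^sup>2 + 3 * n - 3) / 4\<close> half-integral.\<close>

lemma half_exponent_even: "even ((n :: int) * (2 * n ^ 2 + 3 * n - 3))"
  by (cases "even n") auto

end

theory Submission
  imports Defs
begin

text \<open>
  Write \<open>T a\<close> for the theta value at \<open>q\<^sup>a\<close>. Both sides depend on the theta function only through
  \<open>T 1 = \<pi>\<^sub>1\<close> and \<open>T 2 = \<pi>\<^sub>0\<close>: on the left because \<open>\<pi>\<^sub>k = \<pi>\<^bsub>k+1\<^esub> + q\<^bsup>k+1\<^esup> \<pi>\<^bsub>k+2\<^esub>\<close>, on the right because
  \<open>T (a + 5) = - q\<^bsup>-a\<^esup> T a\<close> and \<open>T (5 - a) = T a\<close>. So the identity is finite linear algebra.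

  It comes from two steps of the Bailey lemma. Let \<open>N\<close> be the functional \<open>z\<^sup>k \<mapsto> \<pi>\<^sub>k\<close> on Laurent
  polynomials, for which \<open>N (p z) = N (z p z) + q N (z\<^sup>2 p (q z))\<close>. There are monic polynomials
  \<open>Y\<^sub>a\<close> of degree \<open>a\<close> with \<open>N Y\<^sub>a = T (2 - a)\<close>. The array \<open>h a b = N (Y\<^sub>a z\<^bsup>-b\<^esup>)\<close> arises from the Toeplitz
  matrix of the \<open>\<pi>\<^sub>k\<close> by unitriangular row operations. It also satisfies
  \<open>h a (b + 1) = h (a + 1) b + h (a - 1) b - (1 - q\<^bsup>-b\<^esup>) h a (b - 1)\<close>, the recurrence of the continuous
  \<open>q\<close>-Hermite polynomials in \<open>w + 1 / w\<close>, so triangular column operations turn it into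
  \<open>T (2 + b - a) + T (2 - b - a)\<close>. These are the theta entries up to row factors, with the rows in
  reverse order. The case \<open>\<delta> = 1\<close> uses the companion polynomials of the Bailey lemma relative to
  \<open>q\<close> instead of \<open>1\<close>, and the last identity the differences \<open>Y\<^sub>a - Y\<^bsub>a+1\<^esub>\<close>, which are divisible by
  \<open>1 - z\<close>.
\<close>

section \<open>Functional equations of the theta function\<close>

lemma qpoch_inf_step:
  assumes "norm q < 1"
  shows "qpoch_inf a q = (1 - a) * qpoch_inf (a * q) q"
proof -
  have "(\<lambda>i. 1 - a * q ^ Suc i) has_prod qpoch_inf (a * q) q"
    using qpoch_inf_has_prod[OF assms, of "a * q"] by (simp add: mult.assoc)
  then have "(\<lambda>i. 1 - a * q ^ i) has_prod (qpoch_inf (a * q) q * (1 - a))"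
    using has_prod_Suc_imp[of "\<lambda>i. 1 - a * q ^ i"] by simp
  with qpoch_inf_has_prod[OF assms, of a] show ?thesis
    by (metis has_prod_unique2 mult.commute)
qed

lemma qtheta_shift:
  assumes "norm q < 1" "q \<noteq> 0" "z \<noteq> 0"
  shows "qtheta (z * q) q = - qtheta z q / z"
proof -
  have "qtheta (z * q) q = qpoch_inf (z * q) q * qpoch_inf (1 / z) q"
    using assms by (simp add: qtheta_def)
  also have "\<dots> = (1 - 1 / z) * qpoch_inf (z * q) q * qpoch_inf (q / z) q"
    using qpoch_inf_step[OF assms(1), of "1 / z"] by simp
  also have "\<dots> = - ((1 - z) * qpoch_inf (z * q) q) * qpoch_inf (q / z) q / z"
    using assms by (simp add: field_simps)
  also have "\<dots> = - qtheta z q / z"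
    using qpoch_inf_step[OF assms(1), of z] by (simp add: qtheta_def)
  finally show ?thesis .
qed

lemma qtheta_reflect: "q \<noteq> 0 \<Longrightarrow> qtheta (q / z) q = qtheta z q"
  by (simp add: qtheta_def mult.commute)

section \<open>Exponents of the prefactors\<close>

lemma binom2_step: "binom2 (k + 1) = binom2 k + k"
proof -
  have "(k + 1) * k = k * (k - 1) + k * 2"
    by (simp add: algebra_simps)
  then show ?thesis
    by (simp add: binom2_def)
qed

lemma binom2_double: "2 * binom2 k = k * (k - 1)"
  by (simp add: binom2_def)

text \<open>Adds up the exponents of \<open>s\<close> in the row factors of
  \<open>theta_row_shift\<close>.\<close>

lemma sum_exponent_even:
  "(\<Sum>a<n. - (3 * int a ^ 2 - int a + 3 * d * int a)) = binom2 (int n) * (2 - 2 * int n - 3 * d)"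
proof (induction n)
  case 0
  then show ?case by (simp add: binom2_def)
next
  case (Suc n)
  have b: "binom2 (int (Suc n)) = binom2 (int n) + int n"
    using binom2_step[of "int n"] by (simp add: add.commute)
  have "binom2 (int n) * (2 - 2 * int n - 3 * d) - (3 * int n ^ 2 - int n + 3 * d * int n) =
      (binom2 (int n) + int n) * (2 - 2 * int (Suc n) - 3 * d) + (2 * binom2 (int n) - int n * (int n - 1))"
    by (simp add: algebra_simps power2_eq_square)
  then show ?case
    unfolding b using Suc.IH binom2_double[of "int n"] by simp
qed

text \<open>The same for \<open>theta_row_shift_odd\<close>; the extra \<open>2 * int n\<close> is
  the factor \<open>q ^ n\<close> of \<open>det_odd_col\<close> in powers of
  \<open>s\<close>.\<close>

lemma sum_exponent_odd:
  "(\<Sum>a<n. - (3 * int (Suc a) ^ 2)) + 2 * int n = - (int n * (2 * (int n) ^ 2 + 3 * int n - 3) div 2)"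
proof -
  have "int n * (2 * (int n) ^ 2 + 3 * int n - 3) = 2 * - ((\<Sum>a<n. - (3 * int (Suc a) ^ 2)) + 2 * int n)"
    by (induction n) (simp_all add: algebra_simps power2_eq_square)
  then show ?thesis
    by simp
qed

section \<open>Recursion and initial values of \<open>schur_pi\<close>\<close>

text \<open>For X = D or E, the sign and the power of \<open>q\<close> turn the right side into a
  multiple of \<open>(X k - X (k - 1)) / q powi k\<close>, which is
  \<open>X (k - 2)\<close>.\<close>

lemma schur_pi_rec:
  assumes "q \<noteq> 0"
  shows "schur_pi q k = schur_pi q (k + 1) + q powi (k + 1) * schur_pi q (k + 2)"
proof -
  define B where "B = q powi (- binom2 k)"
  define K where "K = q powi k"
  have K: "K \<noteq> 0" "q powi (k + 1) = K * q"
    using assms by (simp_all add: K_def power_int_add)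
  have b1: "q powi (- binom2 (k + 1)) = B / K"
    using assms by (simp add: binom2_step B_def K_def power_int_diff)
  have "binom2 (k + 2) = binom2 k + k + (k + 1)"
    using binom2_step[of "k + 1"] binom2_step[of k] by (simp add: algebra_simps)
  then have "- binom2 (k + 2) = - binom2 k - k - (k + 1)"
    by simp
  then have "q powi (- binom2 (k + 2)) = q powi ((- binom2 k - k) - (k + 1))"
    by (rule arg_cong)
  also have "\<dots> = q powi (- binom2 k - k) / q powi (k + 1)"
    using assms by (intro power_int_diff) simp
  also have "\<dots> = B / K / (K * q)"
    using assms by (simp add: power_int_diff K(2) B_def K_def)
  finally have b2: "q powi (- binom2 (k + 2)) = B / K / (K * q)" .
  have s: "(-1::complex) powi (k + 1) = - ((-1) powi k)" "(-1::complex) powi (k + 2) = (-1) powi k"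
    by (simp_all add: power_int_add)
  have E: "schur_E q k = schur_E q (k - 1) + K * schur_E q (k - 2)"
    and D: "schur_D q k = schur_D q (k - 1) + K * schur_D q (k - 2)"
    using schur_rec_step[OF assms, of _ _ k] by (simp_all only: schur_E_def schur_D_def K_def)
  have i: "k + 1 - 2 = k - 1" "k + 2 - 2 = k" by simp_all
  show ?thesis
    unfolding schur_pi_def b1 b2 s i E D K(2) B_def[symmetric]
    using K(1) assms by (simp add: field_simps)
qed

text \<open>These two indices read E and D at -2 and -1, where the backward recursion gives only the
  values 0 and 1.\<close>

lemma schur_pi_0_1:
  assumes "q \<noteq> 0"
  shows "schur_pi q 0 = qtheta (q\<^sup>2) (q ^ 5)" "schur_pi q 1 = qtheta q (q ^ 5)"
proof -
  have E: "schur_E q (- 1) = 0" "schur_E q (- 2) = 1"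
    and D: "schur_D q (- 1) = 1" "schur_D q (- 2) = 0"
    using schur_rec_step[OF assms, of 1 1 1] schur_rec_step[OF assms, of 1 1 0]
      schur_rec_step[OF assms, of 1 "1 + q" 1] schur_rec_step[OF assms, of 1 "1 + q" 0] assms
    by (simp_all add: schur_E_def schur_D_def schur_rec_0 schur_rec_1)
  show "schur_pi q 0 = qtheta (q\<^sup>2) (q ^ 5)" "schur_pi q 1 = qtheta q (q ^ 5)"
    by (simp_all add: schur_pi_def binom2_def E D)
qed

section \<open>Triangular changes of basis\<close>

text \<open>One row of a triangular change of basis. Only the diagonal coefficient \<open>l\<close>
  is recorded, since it alone enters a determinant; it belongs to some representation of
  \<open>f\<close>, which may have several.\<close>

definition lead_comb :: "(nat \<Rightarrow> 'x \<Rightarrow> complex) \<Rightarrow> nat \<Rightarrow> complex \<Rightarrow> ('x \<Rightarrow> complex) \<Rightarrow> bool" where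
  "lead_comb e m l f \<longleftrightarrow> (\<exists>y. y m = l \<and> (\<forall>x. f x = (\<Sum>c\<le>m. y c * e c x)))"

lemma lead_comb_zero: "lead_comb e m 0 (\<lambda>_. 0)"
  unfolding lead_comb_def by (intro exI[of _ "\<lambda>_. 0"]) simp

lemma lead_comb_single: "lead_comb e m l (\<lambda>x. l * e m x)"
  unfolding lead_comb_def
  by (intro exI[of _ "\<lambda>c. if c = m then l else 0"]) (simp add: if_distrib[of "\<lambda>u. u * _"] cong: if_cong)

lemma lead_comb_add:
  assumes "lead_comb e m l f" "lead_comb e m k g"
  shows "lead_comb e m (l + k) (\<lambda>x. f x + g x)"
proof -
  obtain y z where "y m = l" "\<And>x. f x = (\<Sum>c\<le>m. y c * e c x)"
    "z m = k" "\<And>x. g x = (\<Sum>c\<le>m. z c * e c x)"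
    using assms unfolding lead_comb_def by blast
  then show ?thesis
    unfolding lead_comb_def
    by (intro exI[of _ "\<lambda>c. y c + z c"]) (simp add: sum.distrib distrib_right)
qed

lemma lead_comb_cmult:
  assumes "lead_comb e m l f"
  shows "lead_comb e m (k * l) (\<lambda>x. k * f x)"
proof -
  obtain y where "y m = l" "\<And>x. f x = (\<Sum>c\<le>m. y c * e c x)"
    using assms unfolding lead_comb_def by blast
  then show ?thesis
    unfolding lead_comb_def
    by (intro exI[of _ "\<lambda>c. k * y c"]) (simp add: sum_distrib_left mult.assoc)
qed

lemma lead_comb_Suc:
  assumes "lead_comb e m l f"
  shows "lead_comb e (Suc m) 0 f"
proof -
  obtain y where "y m = l" "\<And>x. f x = (\<Sum>c\<le>m. y c * e c x)"
    using assms unfolding lead_comb_def by blast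
  then show ?thesis
    unfolding lead_comb_def
    by (intro exI[of _ "\<lambda>c. if c = Suc m then 0 else y c"]) (auto intro!: sum.cong)
qed

lemma lead_comb_le:
  assumes "lead_comb e m l f" "m < k"
  shows "lead_comb e k 0 f"
proof -
  have "lead_comb e (m + Suc d) 0 f" for d
    by (induction d) (use assms lead_comb_Suc in auto)
  from this[of "k - m - 1"] show ?thesis
    using assms(2) by simp
qed

lemma lead_comb_sum:
  assumes "finite A" "\<And>i. i \<in> A \<Longrightarrow> lead_comb e m 0 (f i)"
  shows "lead_comb e m 0 (\<lambda>x. \<Sum>i\<in>A. f i x)"
  using assms
proof (induction A)
  case (insert i A)
  from lead_comb_add[OF insert.prems[of i] insert.IH] insert show ?case by simp
qed (simp add: lead_comb_zero)

text \<open>The terms with \<open>c < m\<close> land below index \<open>m + k\<close>, so only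
  \<open>e m\<close> feeds the leading coefficient. The offset \<open>k\<close> covers maps that
  raise the degree.\<close>

lemma lead_comb_trans:
  assumes "lead_comb e m l f" "\<And>c. c \<le> m \<Longrightarrow> lead_comb e' (c + k) (r c) (e c)"
  shows "lead_comb e' (m + k) (l * r m) f"
proof -
  obtain y where y: "y m = l" "\<And>x. f x = (\<Sum>c\<le>m. y c * e c x)"
    using assms(1) unfolding lead_comb_def by blast
  have "lead_comb e' (m + k) 0 (\<lambda>x. \<Sum>c<m. y c * e c x)"
  proof (rule lead_comb_sum)
    fix c assume "c \<in> {..<m}"
    then have "lead_comb e' (m + k) 0 (e c)"
      using lead_comb_le[OF assms(2)[of c], of "m + k"] by simp
    from lead_comb_cmult[OF this, of "y c"]
    show "lead_comb e' (m + k) 0 (\<lambda>x. y c * e c x)" by simp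
  qed simp
  from lead_comb_add[OF this lead_comb_cmult[OF assms(2)[of m], of l]]
  have "lead_comb e' (m + k) (l * r m) (\<lambda>x. (\<Sum>c<m. y c * e c x) + l * e m x)"
    by simp
  moreover have "f = (\<lambda>x. (\<Sum>c<m. y c * e c x) + l * e m x)"
    by (simp add: y fun_eq_iff lessThan_Suc_atMost[symmetric])
  ultimately show ?thesis by simp
qed

text \<open>The coefficients form a lower triangular matrix with diagonal \<open>l\<close>, which
  splits off on the left whatever the evaluation points \<open>x j\<close> are.\<close>

lemma det_lead_comb:
  fixes e f :: "nat \<Rightarrow> 'x \<Rightarrow> complex"
  assumes "\<And>a. a < n \<Longrightarrow> lead_comb e a (l a) (f a)"
  shows "det (mat n n (\<lambda>(a, j). f a (x j))) = (\<Prod>a<n. l a) * det (mat n n (\<lambda>(a, j). e a (x j)))"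
proof -
  obtain y where y: "\<And>a. a < n \<Longrightarrow> y a a = l a"
      "\<And>a x. a < n \<Longrightarrow> f a x = (\<Sum>c\<le>a. y a c * e c x)"
    using assms unfolding lead_comb_def by metis
  define Y where "Y = mat n n (\<lambda>(a, c). if c \<le> a then y a c else 0)"
  have "mat n n (\<lambda>(a, j). f a (x j)) = Y * mat n n (\<lambda>(a, j). e a (x j))"
  proof (rule eq_matI)
    fix a j assume "a < dim_row (Y * mat n n (\<lambda>(a, j). e a (x j)))"
      "j < dim_col (Y * mat n n (\<lambda>(a, j). e a (x j)))"
    then have aj: "a < n" "j < n" by (auto simp: Y_def)
    have "(\<Sum>c<n. (if c \<le> a then y a c else 0) * e c (x j)) = (\<Sum>c\<le>a. y a c * e c (x j))"
      using aj by (intro sum.mono_neutral_cong_right) auto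
    then show "mat n n (\<lambda>(a, j). f a (x j)) $$ (a, j) = (Y * mat n n (\<lambda>(a, j). e a (x j))) $$ (a, j)"
      using aj by (simp add: Y_def scalar_prod_def y(2) atLeast0LessThan)
  qed (auto simp: Y_def)
  moreover have "det Y = (\<Prod>a<n. l a)"
  proof -
    have "det Y = prod_list (diag_mat Y)"
      by (rule det_lower_triangular[of n]) (auto simp: Y_def)
    also have "\<dots> = (\<Prod>a<n. l a)"
      by (simp add: diag_mat_def Y_def prod.list_conv_set_nth y(1) atLeast0LessThan)
    finally show ?thesis .
  qed
  moreover have "det (Y * mat n n (\<lambda>(a, j). e a (x j))) = det Y * det (mat n n (\<lambda>(a, j). e a (x j)))"
    by (rule det_mult[of _ n]) (auto simp: Y_def)
  ultimately show ?thesis by simp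
qed

lemma det_mat_swap: "det (mat n n (\<lambda>(i, j). f j i)) = det (mat n n (\<lambda>(i, j). f i j :: complex))"
proof -
  have "transpose_mat (mat n n (\<lambda>(i, j). f i j)) = mat n n (\<lambda>(i, j). f j i)"
    by (rule eq_matI) auto
  then show ?thesis
    using det_transpose[of "mat n n (\<lambda>(i, j). f i j)" n] by simp
qed

lemma det_scale_rows:
  "det (mat n n (\<lambda>(i, j). k i * f i j)) = (\<Prod>i<n. k i) * det (mat n n (\<lambda>(i, j). f i j :: complex))"
  by (rule det_lead_comb[of n f k "\<lambda>i j. k i * f i j" id, simplified]) (rule lead_comb_single)

lemma det_reverse_rows:
  "det (mat n n (\<lambda>(i, j). f (n - 1 - i) j)) = (\<Prod>i<n. (- 1) ^ i) * det (mat n n (\<lambda>(i, j). f i j :: complex))"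
proof -
  \<comment> \<open>The first \<open>m\<close> rows of \<open>A m\<close> are reversed; moving row
    \<open>m\<close> to the top takes \<open>m\<close> transpositions and gives
    \<open>A (Suc m)\<close>.\<close>
  define A where "A m = mat n n (\<lambda>(i, j). f (if i < m then m - 1 - i else i) j)" for m
  have "det (A m) = (\<Prod>i<m. (- 1) ^ i) * det (mat n n (\<lambda>(i, j). f i j))" if "m \<le> n" for m
    using that
  proof (induction m)
    case 0
    then show ?case by (simp add: A_def)
  next
    case (Suc m)
    have "mat n n (\<lambda>(i, j). A m $$ (if i < 1 then i + m else if i < m + 1 then i - 1 else i, j)) = A (Suc m)"
      using Suc.prems by (intro eq_matI) (auto simp: A_def)
    moreover have "A m \<in> carrier_mat n n" by (simp add: A_def)
    ultimately have "det (A m) = (- 1) ^ m * det (A (Suc m))"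
      using det_swap_initial_rows[of "A m" n m 1] Suc.prems by simp
    then have "det (A (Suc m)) = (- 1) ^ m * det (A m)"
      by (simp flip: mult.assoc power_mult_distrib)
    then show ?case
      using Suc by simp
  qed
  moreover have "A n = mat n n (\<lambda>(i, j). f (n - 1 - i) j)"
    by (intro eq_matI) (auto simp: A_def)
  ultimately show ?thesis
    using \<open>\<And>m. m \<le> n \<Longrightarrow> det (A m) = (\<Prod>i<m. (- 1) ^ i) * det (mat n n (\<lambda>(i, j). f i j))\<close>[of n]
    by simp
qed

text \<open>Substitution in the argument and multiplication by a function of it are linear, so the
  coefficients stay the same.\<close>

lemma lead_comb_op:
  assumes "lead_comb e m l f"
  shows "lead_comb (\<lambda>c x. \<alpha> x * e c (\<phi> x) + \<beta> x * e c (\<psi> x) + \<gamma> x * e c (\<rho> x)) m l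
    (\<lambda>x. \<alpha> x * f (\<phi> x) + \<beta> x * f (\<psi> x) + \<gamma> x * f (\<rho> x))"
proof -
  obtain y where "y m = l" "\<And>x. f x = (\<Sum>c\<le>m. y c * e c x)"
    using assms unfolding lead_comb_def by blast
  then show ?thesis
    unfolding lead_comb_def
    by (intro exI[of _ y]) (simp add: sum_distrib_left sum.distrib[symmetric] algebra_simps)
qed

section \<open>Columns generated by a q-Hermite recurrence\<close>

text \<open>With \<open>w\<close> acting as the unit shift of the argument of \<open>G\<close>, this
  is the image of \<open>w^c + w^(-c)\<close>; the column \<open>c = 0\<close> is therefore
  doubled.\<close>

definition even_col :: "(int \<Rightarrow> complex) \<Rightarrow> nat \<Rightarrow> nat \<Rightarrow> complex" where
  "even_col G c a = G (int c - int a) + G (- int c - int a)"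

text \<open>Adding rows \<open>a + 1\<close> and \<open>a - 1\<close> is multiplication by
  \<open>w + 1/w\<close>, so \<open>X b\<close> is a polynomial of degree \<open>b\<close> in it. At
  \<open>a = 0\<close> the truncated \<open>a - 1\<close> is 0, and \<open>\<epsilon>\<close> times
  row 0 stands for row -1; \<open>bnd\<close> says that \<open>even_col\<close> continues to row -1
  in this way.\<close>

lemma lead_comb_even_col:
  fixes X :: "nat \<Rightarrow> nat \<Rightarrow> complex"
  assumes bnd: "\<And>c. \<epsilon> * (G (int c) + G (- int c)) = G (int c + 1) + G (1 - int c)"
    and X0: "\<And>a. X 0 a = G (- int a)"
    and X1: "\<And>a. X 1 a = \<sigma> * (X 0 (Suc a) + (if a = 0 then \<epsilon> else 1) * X 0 (a - 1))"
    and X2: "\<And>a b. X (Suc (Suc b)) a =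
      \<sigma> * (X (Suc b) (Suc a) + (if a = 0 then \<epsilon> else 1) * X (Suc b) (a - 1)) - \<gamma> b * X b a"
  shows "lead_comb (even_col G) b (if b = 0 then 1 / 2 else \<sigma> ^ b) (X b)"
proof -
  define \<beta> where "\<beta> a = (if a = 0 then \<epsilon> else 1)" for a :: nat
  let ?t = "even_col G"
  have t: "?t c (Suc a) + \<beta> a * ?t c (a - 1) =
      (G (int c - int a - 1) + G (- int c - int a - 1)) + (G (int c - int a + 1) + G (- int c - int a + 1))"
    for c a
  proof (cases a)
    case 0
    then show ?thesis
      using bnd[of c] by (simp add: even_col_def \<beta>_def add.commute)
  next
    case (Suc k)
    have "int c - int (Suc a) = int c - int a - 1" "- int c - int (Suc a) = - int c - int a - 1"
      "int c - int (a - 1) = int c - int a + 1" "- int c - int (a - 1) = - int c - int a + 1"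
      by (simp_all add: Suc)
    moreover have "\<beta> a = 1"
      by (simp add: Suc \<beta>_def)
    ultimately show ?thesis
      by (simp only: even_col_def mult_1)
  qed
  \<comment> \<open>The factor 2 at \<open>m = 0\<close> comes from the doubled column 0 and later
    cancels the initial 1/2.\<close>
  have step: "lead_comb ?t (Suc m) (\<sigma> * (l * (if m = 0 then 2 else 1)))
      (\<lambda>a. \<sigma> * (f (Suc a) + \<beta> a * f (a - 1)))"
    if "lead_comb ?t m l f" for m l f
  proof -
    have "lead_comb (\<lambda>c a. ?t c (Suc a) + \<beta> a * ?t c (a - 1)) m l (\<lambda>a. f (Suc a) + \<beta> a * f (a - 1))"
      using lead_comb_op[OF that, of "\<lambda>_. 1" Suc \<beta> "\<lambda>a. a - 1" "\<lambda>_. 0" id] by simp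
    moreover have "lead_comb ?t (c + 1) (if c = 0 then 2 else 1) (\<lambda>a. ?t c (Suc a) + \<beta> a * ?t c (a - 1))" for c
    proof (cases c)
      case 0
      have "(\<lambda>a. ?t c (Suc a) + \<beta> a * ?t c (a - 1)) = (\<lambda>a. 2 * ?t 1 a)"
        unfolding t by (simp add: 0 even_col_def fun_eq_iff add.commute minus_diff_commute)
      then show ?thesis
        using lead_comb_single[of ?t 1 2] 0 by simp
    next
      case (Suc k)
      have "int (Suc k) - int a - 1 = int k - int a"
        "- int (Suc k) - int a - 1 = - int (Suc (Suc k)) - int a"
        "int (Suc k) - int a + 1 = int (Suc (Suc k)) - int a"
        "- int (Suc k) - int a + 1 = - int k - int a" for a
        by simp_all
      then have eq: "(\<lambda>a. ?t c (Suc a) + \<beta> a * ?t c (a - 1)) = (\<lambda>a. 1 * ?t (Suc (Suc k)) a + 1 * ?t k a)"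
        unfolding t Suc by (simp only: even_col_def mult_1 add_ac)
      have "lead_comb ?t (Suc (Suc k)) 0 (\<lambda>a. 1 * ?t k a)"
        using lead_comb_le[OF lead_comb_single[of ?t k 1], of "Suc (Suc k)"] by simp
      from lead_comb_add[OF lead_comb_single[of ?t "Suc (Suc k)" 1] this]
      show ?thesis
        unfolding eq by (simp add: Suc)
    qed
    ultimately show ?thesis
      using lead_comb_cmult[OF lead_comb_trans[of _ m l _ ?t 1 "\<lambda>c. if c = 0 then 2 else 1"]] by simp
  qed
  show ?thesis
  proof (induction b rule: less_induct)
    case (less b)
    consider "b = 0" | "b = 1" | k where "b = Suc (Suc k)"
      by (metis One_nat_def not0_implies_Suc)
    then show ?case
    proof cases
      case 1
      have "X 0 = (\<lambda>a. 1 / 2 * ?t 0 a)" by (simp add: X0 even_col_def fun_eq_iff)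
      then show ?thesis
        using lead_comb_single[of ?t 0 "1 / 2"] 1 by simp
    next
      case 2
      have "X 1 = (\<lambda>a. \<sigma> * (X 0 (Suc a) + \<beta> a * X 0 (a - 1)))"
        unfolding \<beta>_def by (rule ext) (rule X1)
      then show ?thesis
        using step[OF less[of 0]] 2 by simp
    next
      case 3
      have eq: "X b = (\<lambda>a. \<sigma> * (X (Suc k) (Suc a) + \<beta> a * X (Suc k) (a - 1)) + (- \<gamma> k) * X k a)"
        by (rule ext) (simp add: 3 X2 \<beta>_def)
      have "lead_comb ?t (Suc (Suc k)) 0 (\<lambda>a. (- \<gamma> k) * X k a)"
        using lead_comb_cmult[OF lead_comb_le[OF less[of k], of "Suc (Suc k)"], of "- \<gamma> k"] 3 by simp
      from lead_comb_add[OF step[OF less[of "Suc k"]] this] 3 show ?thesis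
        unfolding eq by simp
    qed
  qed
qed

lemma det_lead_comb_columns:
  fixes e f :: "nat \<Rightarrow> 'x \<Rightarrow> complex"
  assumes "\<And>b. b < n \<Longrightarrow> lead_comb e b (l b) (f b)"
  shows "det (mat n n (\<lambda>(i, b). f b (x i))) = (\<Prod>b<n. l b) * det (mat n n (\<lambda>(i, b). e b (x i)))"
  using det_lead_comb[OF assms] det_mat_swap[of n "\<lambda>i b. f b (x i)"] det_mat_swap[of n "\<lambda>i b. e b (x i)"]
  by simp

text \<open>The single 1/2 at \<open>b = 0\<close> is the source of the factor 2 in the first
  identity.\<close>

lemma prod_half:
  "n \<ge> 1 \<Longrightarrow> (\<Prod>b<n. if b = 0 then 1 / 2 else \<sigma> ^ b) = (\<Prod>b<n. \<sigma> ^ b) / (2 :: complex)"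
  by (induction n rule: dec_induct) auto

lemma det_upto_shift:
  "det_upto n (\<lambda>i j. f (d + i - j)) = det (mat n n (\<lambda>(a, b). f (d + int a - int b)))"
  by (simp add: det_upto_def add.assoc[symmetric])

section \<open>The reduction\<close>

locale schur_system =
  fixes q s :: complex and p T :: "int \<Rightarrow> complex"
  assumes q_nz: "q \<noteq> 0"
    and s_sq: "s\<^sup>2 = q"
    and p_rec: "p k = p (k + 1) + q powi (k + 1) * p (k + 2)"
    and T_shift: "T (a + 5) = - (q powi (- a)) * T a"
    and T_reflect: "T (5 - a) = T a"
    and T_1: "T 1 = p 1"
    and T_2: "T 2 = p 0"
begin

text \<open>
  In terms of \<open>N\<close>, \<open>H (a + 3) b = N (Y'\<^sub>a z\<^bsup>-b\<^esup>)\<close> for the companions \<open>Y'\<^sub>a\<close> with \<open>Y\<^sub>a = Y'\<^sub>a - q z Y'\<^bsub>a-1\<^esub>\<close>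
  and \<open>- q\<^bsup>a-1\<^esup> Y\<^sub>a = Y'\<^bsub>a-3\<^esub> - z Y'\<^bsub>a-2\<^esub>\<close>; eliminating \<open>Y\<^sub>a\<close> gives the recursion.
\<close>

fun H :: "nat \<Rightarrow> int \<Rightarrow> complex" where
  "H 0 b = - p (- b) / q"
| "H (Suc 0) b = 0"
| "H (Suc (Suc 0)) b = p (- b)"
| "H (Suc (Suc (Suc k))) b =
     q * H (Suc (Suc k)) (b - 1) + q powi (1 - int k) * (H (Suc k) (b - 1) - H k b)"

declare H.simps [simp del]

section \<open>Contiguous relations of the arrays \<open>H\<close> and \<open>h\<close>\<close>

lemma p_rec': "p (- b - 1) = p (- b) + q powi (- b) * p (1 - b)"
  using p_rec[of "- b - 1"] by (simp add: algebra_simps)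

text \<open>The q-Hermite type relation for the companions. Three initial rows follow from the
  recursion of \<open>p\<close>; after that both sides propagate by the recursion defining
  \<open>H\<close>.\<close>

lemma H_contiguous:
  "H (Suc k) (b + 1) = H (Suc (Suc k)) b + q * H k b - (q - q powi (- b)) * H (Suc k) (b - 1)"
proof (induction k arbitrary: b rule: less_induct)
  case (less k)
  define R where "R = q powi (- b)"
  have R: "q powi (1 - b) = q * R" "q powi (- b) = R"
    using q_nz by (simp_all add: R_def power_int_diff power_int_minus field_simps)
  have p1: "p (- b - 1) = p (- b) + R * p (1 - b)" "p (- b) = p (1 - b) + q * R * p (2 - b)"
    using p_rec'[of b] p_rec'[of "b - 1"] by (simp_all add: R)
  consider "k = 0" | "k = Suc 0" | "k = Suc (Suc 0)" | j where "k = Suc (Suc (Suc j))"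
    by (metis not0_implies_Suc)
  then show ?case
  proof cases
    case 1
    then show ?thesis using q_nz by (simp add: H.simps)
  next
    case 2
    have [simp]: "- 1 - b = - b - 1" by simp
    have "H 3 b = q * p (1 - b) + p (- b)"
      using q_nz by (simp add: numeral_3_eq_3 H.simps)
    then show ?thesis
      using p1(1) q_nz unfolding 2 R by (simp add: algebra_simps numeral_3_eq_3 H.simps(2,3))
  next
    case 3
    have [simp]: "- 1 - b = - b - 1" by simp
    have "H 3 c = q * p (1 - c) + p (- c)" for c
      using q_nz by (simp add: numeral_3_eq_3 H.simps)
    moreover have "H 4 c = q * (q * p (2 - c) + p (1 - c)) + p (1 - c)" for c
      using q_nz by (simp add: eval_nat_numeral H.simps)
    ultimately show ?thesis
      using q_nz unfolding 3 R by (simp add: p1 algebra_simps eval_nat_numeral H.simps(2,3))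
  next
    case 4
    let ?j1 = "Suc j" let ?j2 = "Suc ?j1" let ?j3 = "Suc ?j2" let ?j4 = "Suc ?j3" let ?j5 = "Suc ?j4"
    define P where "P = q powi (- 1 - int j)"
    have P: "q powi (- int j) = q * P" "q powi (1 - int j) = q * q * P" "q powi (- 1 - int j) = P"
      using q_nz by (simp_all add: P_def power_int_diff power_int_minus field_simps)
    have rec3: "H ?j3 c = q * H ?j2 (c - 1) + q * q * P * (H ?j1 (c - 1) - H j c)" for c
      by (simp add: P H.simps)
    have rec4: "H ?j4 c = q * H ?j3 (c - 1) + q * P * (H ?j2 (c - 1) - H ?j1 c)" for c
      using H.simps(4)[of ?j1 c] by (simp add: P)
    have rec5: "H ?j5 c = q * H ?j4 (c - 1) + P * (H ?j3 (c - 1) - H ?j2 c)" for c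
      using H.simps(4)[of ?j2 c] by (simp add: P)
    \<comment> \<open>The claim reads \<open>V k b = q powi (- b) * H (Suc k) (b - 1)\<close>. The
      recursion shown below for \<open>V ?j3 b\<close> holds for the right side as well, where the
      shift of \<open>b\<close> costs a factor \<open>q\<close>.\<close>
    define V where "V k b = H (Suc k) (b + 1) - H (Suc (Suc k)) b - q * H k b + q * H (Suc k) (b - 1)"
      for k b
    have "V j b = R * H ?j1 (b - 1)"
      "V ?j1 (b - 1) = q * R * H ?j2 (b - 2)"
      "V ?j2 (b - 1) = q * R * H ?j3 (b - 2)"
      using less[of j b] less[of ?j1 "b - 1"] less[of ?j2 "b - 1"]
      by (simp_all add: 4 V_def R algebra_simps)
    moreover have "V ?j3 b = V ?j2 (b - 1) + P * V ?j1 (b - 1) - q * P * V j b"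
      unfolding V_def rec5[of b] rec4[of "b + 1"] rec4[of "b - 1"]
      by (simp add: algebra_simps) (simp add: rec4[of "b - 1"] rec3[of b] algebra_simps)
    ultimately have "V ?j3 b = R * (q * H ?j3 (b - 2) + q * P * (H ?j2 (b - 2) - H ?j1 (b - 1)))"
      by (simp add: algebra_simps)
    then have "V ?j3 b = R * H ?j4 (b - 1)"
      using rec4[of "b - 1"] by simp
    then show ?thesis
      by (simp add: V_def 4 R algebra_simps)
  qed
qed

lemma s_nz: "s \<noteq> 0"
  using q_nz s_sq by auto

text \<open>This is \<open>N (Y_a z^(-b))\<close>, written with the second relation between
  \<open>Y\<close> and its companions; \<open>h_eq\<close> is the first one.\<close>

definition h :: "nat \<Rightarrow> int \<Rightarrow> complex" where
  "h a b = q powi (1 - int a) * (H (Suc a) (b - 1) - H a b)"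

lemma h_0: "h 0 b = p (- b)"
  using q_nz by (simp add: h_def H.simps)

lemma h_1: "h (Suc 0) b = p (1 - b)"
  by (simp add: h_def H.simps)

lemma h_eq: "h a b = H (a + 3) b - q * H (a + 2) (b - 1)"
  by (simp add: h_def numeral_3_eq_3 H.simps)

text \<open>Obtained by writing every term through rows \<open>c + 3\<close> and
  \<open>c + 4\<close> of \<open>H\<close>, where \<open>a = c + 1\<close>. For \<open>a = 0\<close>
  the truncated \<open>a - 1\<close> makes row -1 equal to row 0.\<close>

lemma h_contiguous:
  "h a (b + 1) = h (Suc a) b + h (a - 1) b - (1 - q powi (- b)) * h a (b - 1)"
proof (cases a)
  case 0
  have [simp]: "- 1 - b = - b - 1" by simp
  show ?thesis
    using p_rec'[of b] by (simp add: 0 h_0 h_1 algebra_simps)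
next
  case (Suc c)
  have "q powi (1 - b) = q * q powi (- b)"
    using q_nz by (simp add: power_int_diff power_int_minus field_simps)
  then have e1: "h c b = H (c + 4) (b - 1) - q * (1 - q powi (- b)) * H (c + 3) (b - 2)"
    using H_contiguous[of "c + 2" "b - 1"] by (simp add: h_eq eval_nat_numeral algebra_simps)
  have e2: "h (c + 1) (b + 1) = H (c + 5) b - (q - q powi (- b)) * H (c + 4) (b - 1)"
    using H_contiguous[of "c + 3" "b"] by (simp add: h_eq eval_nat_numeral)
  have e3: "H (c + 5) b = h (c + 2) b + q * H (c + 4) (b - 1)"
    and e4: "H (c + 4) (b - 1) = h (c + 1) (b - 1) + q * H (c + 3) (b - 2)"
    using h_eq[of "c + 2" b] h_eq[of "c + 1" "b - 1"] by (simp_all add: eval_nat_numeral)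
  have "h (c + 1) (b + 1) = h (c + 2) b + h c b - (1 - q powi (- b)) * h (c + 1) (b - 1)"
    unfolding e1 e2 e3 e4 by (simp add: algebra_simps)
  then show ?thesis
    by (simp add: Suc)
qed

text \<open>The last coefficient of \<open>H_contiguous\<close> vanishes at \<open>b = -1\<close>;
  this makes that column the link to the theta values.\<close>

lemma H_contiguous_m1: "H (Suc k) 0 = H (Suc (Suc k)) (- 1) + q * H k (- 1)"
  using H_contiguous[of k "- 1"] by simp

lemma h_at_0: "h a 0 = H (a + 4) (- 1)"
  using H_contiguous_m1[of "a + 2"] by (simp add: h_eq eval_nat_numeral)

lemma T_5: "T 5 = 0"
  using T_shift[of 0] T_reflect[of 0] by simp

text \<open>Five initial values are checked from \<open>T_1\<close>, \<open>T_2\<close> and the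
  symmetries of \<open>T\<close>. Moving \<open>k\<close> by 5 multiplies the column by the same
  factor as \<open>T_shift\<close>.\<close>

lemma H_m1: "H k (- 1) = T (6 - int k)"
proof (induction k rule: less_induct)
  case (less k)
  consider "k = 0" | "k = 1" | "k = 2" | "k = 3" | "k = 4" | j where "k = j + 5"
    by atomize_elim presburger
  then show ?case
  proof cases
    case 1
    then show ?thesis
      using T_shift[of 1] q_nz by (simp add: T_1 H.simps power_int_minus field_simps)
  next
    case 2
    then show ?thesis by (simp add: T_5 H.simps)
  next
    case 3
    then show ?thesis
      using T_reflect[of 1] by (simp add: T_1 H.simps numeral_2_eq_2)
  next
    case 4
    then show ?thesis
      using T_reflect[of 2] q_nz p_rec[of 0] by (simp add: T_2 H.simps numeral_3_eq_3)
  next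
    case 5
    then show ?thesis
      using h_at_0[of 0] h_0[of 0] by (simp add: T_2)
  next
    case 6
    have "H k (- 1) = h (Suc j) 0"
      by (simp add: h_at_0 6 eval_nat_numeral)
    also have "\<dots> = - (q powi (1 - int j)) * H j (- 1)"
      using q_nz by (simp add: h_def H_contiguous_m1 power_int_diff power_int_minus field_simps)
    also have "\<dots> = - (q powi (1 - int j)) * T (6 - int j)"
      using less[of j] 6 by simp
    also have "\<dots> = T (6 - int k)"
    proof -
      have "T (6 - int j) = - (q powi (int j - 1)) * T (1 - int j)"
        using T_shift[of "1 - int j"] by (simp add: algebra_simps)
      then show ?thesis
        using q_nz 6 by (simp add: power_int_diff field_simps)
    qed
    finally show ?thesis .
  qed
qed

section \<open>Row operations: from the Toeplitz matrix to \<open>H\<close> and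
  \<open>h\<close>\<close>

text \<open>Replacing \<open>b\<close> by \<open>b - 1\<close> multiplies the polynomial under
  \<open>N\<close> by \<open>z\<close>.\<close>

lemma lead_comb_shift:
  assumes "lead_comb (\<lambda>c b. p (int c - b)) m l f"
  shows "lead_comb (\<lambda>c b. p (int c - b)) (Suc m) l (\<lambda>b. f (b - 1))"
proof -
  have "lead_comb (\<lambda>c b. p (int c - (b - 1))) m l (\<lambda>b. f (b - 1))"
    using lead_comb_op[OF assms, of "\<lambda>_. 1" "\<lambda>b. b - 1" "\<lambda>_. 0" id "\<lambda>_. 0" id] by simp
  moreover have "lead_comb (\<lambda>c b. p (int c - b)) (c + 1) 1 (\<lambda>b. p (int c - (b - 1)))" for c
    using lead_comb_single[of "\<lambda>c b. p (int c - b)" "c + 1" 1] by (simp add: algebra_simps)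
  ultimately show ?thesis
    using lead_comb_trans[of "\<lambda>c b. p (int c - (b - 1))" m l _ _ 1 "\<lambda>_. 1"] by simp
qed

text \<open>From \<open>k = 3\<close> on, only the term \<open>q * H (k + 1) (b - 1)\<close> of the
  recursion reaches degree \<open>k\<close>, so each step contributes one factor
  \<open>q\<close>.\<close>

lemma H_lead: "lead_comb (\<lambda>c b. p (int c - b)) k (q ^ k) (H (k + 2))"
proof (induction k rule: less_induct)
  case (less k)
  let ?e = "\<lambda>c b. p (int c - b)"
  have H2: "lead_comb ?e 0 1 (H 2)"
    using lead_comb_single[of ?e 0 1] by (simp add: numeral_2_eq_2 H.simps(3)[abs_def])
  have H3: "H 3 = (\<lambda>b. q * H 2 (b - 1) + H 2 b)"
    using q_nz by (simp add: fun_eq_iff numeral_3_eq_3 numeral_2_eq_2 H.simps)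
  have L3: "lead_comb ?e 1 q (H 3)"
    using lead_comb_add[OF lead_comb_cmult[OF lead_comb_shift[OF H2], of q] lead_comb_Suc[OF H2]]
    by (simp add: H3)
  have H4: "H 4 = (\<lambda>b. q * H 3 (b - 1) + H 2 (b - 1))"
    using q_nz H.simps(4)[of 1] by (simp add: fun_eq_iff eval_nat_numeral H.simps(2))
  have L4: "lead_comb ?e 2 (q * q) (H 4)"
    using lead_comb_add[OF lead_comb_cmult[OF lead_comb_shift[OF L3[unfolded One_nat_def]], of q]
        lead_comb_Suc[OF lead_comb_shift[OF H2]]]
    by (simp add: H4 numeral_2_eq_2)
  consider "k = 0" | "k = 1" | "k = 2" | j where "k = j + 3"
    by atomize_elim presburger
  then show ?case
  proof cases
    case 4
    define r where "r = q powi (- 1 - int j)"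
    have eq: "H (k + 2) = (\<lambda>b. (q * H (j + 4) (b - 1) + r * H (j + 3) (b - 1)) + (- r) * H (j + 2) b)"
      using H.simps(4)[of "j + 2"] by (simp add: 4 fun_eq_iff eval_nat_numeral r_def algebra_simps)
    have "lead_comb ?e (Suc (j + 2)) (q * q ^ (j + 2)) (\<lambda>b. q * H (j + 4) (b - 1))"
      using lead_comb_cmult[OF lead_comb_shift[OF less[of "j + 2"]], of q] 4
      by (simp add: eval_nat_numeral)
    moreover have "lead_comb ?e (Suc (j + 2)) 0 (\<lambda>b. r * H (j + 3) (b - 1))"
      using lead_comb_cmult[OF lead_comb_Suc[OF lead_comb_shift[OF less[of "j + 1"]]], of r] 4
      by (simp add: eval_nat_numeral)
    moreover have "lead_comb ?e (Suc (j + 2)) 0 (\<lambda>b. (- r) * H (j + 2) b)"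
      using lead_comb_cmult[OF lead_comb_le[OF less[of j], of "Suc (j + 2)"], of "- r"] 4 by simp
    ultimately have "lead_comb ?e (Suc (j + 2)) (q * q ^ (j + 2) + 0 + 0) (H (k + 2))"
      unfolding eq by (intro lead_comb_add)
    then show ?thesis
      using 4 by (simp add: eval_nat_numeral)
  qed (use H2 L3 L4 in \<open>simp_all add: numeral_eq_Suc\<close>)
qed

lemma h_lead: "lead_comb (\<lambda>c b. p (int c - b)) a 1 (h a)"
proof -
  let ?e = "\<lambda>c b. p (int c - b)"
  consider "a = 0" | "a = 1" | j where "a = j + 2"
    by atomize_elim presburger
  then show ?thesis
  proof cases
    case 1
    then show ?thesis
      using lead_comb_single[of ?e 0 1] by (simp add: h_0[abs_def])
  next
    case 2
    then show ?thesis
      using lead_comb_single[of ?e 1 1] by (simp add: h_1[abs_def])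
  next
    case 3
    define r where "r = q powi (- 1 - int j)"
    have eq: "h a = (\<lambda>b. r * H (j + 3) (b - 1) + (- r) * H (j + 2) b)"
      by (simp add: fun_eq_iff eval_nat_numeral r_def h_def 3 algebra_simps)
    have "lead_comb ?e (Suc (j + 1)) (r * q ^ (j + 1)) (\<lambda>b. r * H (j + 3) (b - 1))"
      using lead_comb_cmult[OF lead_comb_shift[OF H_lead[of "j + 1"]], of r] by (simp add: eval_nat_numeral)
    moreover have "lead_comb ?e (Suc (j + 1)) 0 (\<lambda>b. (- r) * H (j + 2) b)"
      using lead_comb_cmult[OF lead_comb_le[OF H_lead[of j], of "Suc (j + 1)"], of "- r"] by simp
    ultimately have "lead_comb ?e (Suc (j + 1)) (r * q ^ (j + 1) + 0) (h a)"
      unfolding eq by (intro lead_comb_add)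
    moreover have "r * q ^ (j + 1) = 1"
      using q_nz by (simp add: r_def power_int_diff power_int_minus)
    ultimately show ?thesis
      using 3 by simp
  qed
qed

section \<open>Column operations: from \<open>h\<close> and \<open>H\<close> to theta values\<close>

text \<open>Here \<open>\<epsilon> = 1\<close>: by \<open>T_reflect\<close> the row -1 of the theta
  columns equals row 0.\<close>

lemma h_columns:
  "lead_comb (even_col (\<lambda>x. T (2 + x))) b (if b = 0 then 1 / 2 else 1) (\<lambda>a. h a (int b))"
proof -
  have refl3: "T (3 + x) = T (2 - x)" for x
    using T_reflect[of "2 - x"] by (simp add: algebra_simps)
  have "lead_comb (even_col (\<lambda>x. T (2 + x))) b (if b = 0 then 1 / 2 else 1 ^ b) (\<lambda>a. h a (int b))"
  proof (rule lead_comb_even_col[where \<epsilon> = 1 and \<gamma> = "\<lambda>b. 1 - q powi (- int (Suc b))"])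
    show "1 * (T (2 + int c) + T (2 + - int c)) = T (2 + (int c + 1)) + T (2 + (1 - int c))" for c
      using refl3[of "int c"] refl3[of "- int c"] by (simp add: algebra_simps)
    show "h a (int 0) = T (2 + - int a)" for a
      by (simp add: h_at_0 H_m1)
    show "h a (int 1) = 1 * (h (Suc a) (int 0) + (if a = 0 then 1 else 1) * h (a - 1) (int 0))" for a
      using h_contiguous[of a 0] by simp
    show "h a (int (Suc (Suc b))) = 1 * (h (Suc a) (int (Suc b))
        + (if a = 0 then 1 else 1) * h (a - 1) (int (Suc b)))
      - (1 - q powi (- int (Suc b))) * h a (int b)" for a b
      using h_contiguous[of a "int (Suc b)"] by (simp add: algebra_simps)
  qed
  then show ?thesis by (simp split: if_splits)
qed

text \<open>The scaling by \<open>s powi (- int a)\<close> turns the unequal coefficients 1 and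
  \<open>q\<close> in \<open>H_contiguous\<close> into \<open>s\<close> and \<open>s\<close>. Column
  0 sits at \<open>b = -1\<close>, where \<open>H_m1\<close> applies.\<close>

definition H_half :: "nat \<Rightarrow> nat \<Rightarrow> complex" where
  "H_half b a = s powi (- int a) * H (a + 2) (int b - 1)"

lemma q_powi: "q powi k = s powi (2 * k)"
  by (simp add: power_int_power flip: s_sq)

text \<open>Here \<open>\<epsilon> = 0\<close>, because \<open>H 1\<close> is zero; correspondingly
  row -1 of the theta columns cancels by \<open>T_shift\<close> and
  \<open>T_reflect\<close>.\<close>

lemma H_half_columns:
  "lead_comb (even_col (\<lambda>x. s powi x * T (4 + x))) b (if b = 0 then 1 / 2 else s ^ b) (H_half b)"
proof (rule lead_comb_even_col[where \<epsilon> = 0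
      and \<gamma> = "\<lambda>b. q - q powi (- int b)"])
  have rec: "s powi (- int a) * H (a + 2) (b + 1) =
    s * (s powi (- int (Suc a)) * H (Suc a + 2) b
      + (if a = 0 then 0 else 1) * (s powi (- int (a - 1)) * H (a - 1 + 2) b))
    - (q - q powi (- b)) * (s powi (- int a) * H (a + 2) (b - 1))" for a b
  proof -
    define u where "u = s powi (- int a)"
    have e1: "s powi (- int (Suc a)) = u / s"
      using s_nz by (simp add: u_def power_int_diff power_int_minus field_simps)
    have e2: "(if a = 0 then 0 else 1) * (s powi (- int (a - 1)) * H (a - 1 + 2) b) = u * s * H (a + 1) b"
      using s_nz by (cases a) (simp_all add: u_def power_int_diff power_int_minus field_simps H.simps(2))
    have e3: "H (a + 2) (b + 1) = H (Suc a + 2) b + s * s * H (a + 1) b - (q - q powi (- b)) * H (a + 2) (b - 1)"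
      using H_contiguous[of "a + 1" b] by (simp add: power2_eq_square[symmetric] s_sq)
    show ?thesis
      unfolding e1 e2 e3 u_def[symmetric] using s_nz by (simp add: field_simps)
  qed
  show "H_half 0 a = s powi (- int a) * T (4 + - int a)" for a
    by (simp add: H_half_def H_m1)
  show "H_half 1 a = s * (H_half 0 (Suc a) + (if a = 0 then 0 else 1) * H_half 0 (a - 1))" for a
    using rec[of a "-1"] by (simp add: H_half_def)
  show "H_half (Suc (Suc b)) a = s * (H_half (Suc b) (Suc a) + (if a = 0 then 0 else 1) * H_half (Suc b) (a - 1))
     - (q - q powi (- int b)) * H_half b a" for a b
  proof -
    have i: "int (Suc (Suc b)) - 1 = int b + 1" "int (Suc b) - 1 = int b"
      by simp_all
    show ?thesis
      unfolding H_half_def i by (rule rec)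
  qed
  show "0 * (s powi int c * T (4 + int c) + s powi (- int c) * T (4 + - int c)) =
      s powi (int c + 1) * T (4 + (int c + 1)) + s powi (1 - int c) * T (4 + (1 - int c))" for c
  proof -
    have "s powi (1 + int c) * q powi (- int c) = s powi (1 - int c)"
      using s_nz by (simp add: q_powi flip: power_int_add)
    then show ?thesis
      using T_shift[of "int c"] T_reflect[of "int c"] by (simp add: add.commute mult.assoc[symmetric])
  qed
qed

text \<open>The image of \<open>w^c - w^(-c-1)\<close>, that is, of a basis of the multiples of
  \<open>1 - 1/w\<close> that arise from \<open>w^c + w^(-c)\<close>.\<close>

definition odd_col :: "nat \<Rightarrow> nat \<Rightarrow> complex" where
  "odd_col c a = T (2 + (int c - int a)) - T (2 + (- int (Suc c) - int a))"

text \<open>Subtracting the next row multiplies by \<open>1 - 1/w\<close>, and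
  \<open>(w^c + w^(-c)) (1 - 1/w)\<close> is \<open>odd_col c - odd_col (c - 1)\<close>, or
  \<open>2 odd_col 0\<close> for \<open>c = 0\<close>.\<close>

lemma h_diff_columns: "lead_comb odd_col b 1 (\<lambda>a. h a (int b) - h (Suc a) (int b))"
proof -
  have "lead_comb (\<lambda>c a. even_col (\<lambda>x. T (2 + x)) c a - even_col (\<lambda>x. T (2 + x)) c (Suc a)) b (if b = 0 then 1 / 2 else 1)
      (\<lambda>a. h a (int b) - h (Suc a) (int b))"
    using lead_comb_op[OF h_columns, of "\<lambda>_. 1" id "\<lambda>_. - 1" Suc "\<lambda>_. 0" id] by simp
  moreover have "lead_comb odd_col (c + 0) (if c = 0 then 2 else 1) (\<lambda>a. even_col (\<lambda>x. T (2 + x)) c a - even_col (\<lambda>x. T (2 + x)) c (Suc a))" for c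
  proof (cases c)
    case 0
    have "(\<lambda>a. even_col (\<lambda>x. T (2 + x)) c a - even_col (\<lambda>x. T (2 + x)) c (Suc a)) = (\<lambda>a. 2 * odd_col 0 a)"
      by (simp add: fun_eq_iff even_col_def odd_col_def 0)
    then show ?thesis
      using lead_comb_single[of odd_col 0 2] 0 by simp
  next
    case (Suc k)
    have "even_col (\<lambda>x. T (2 + x)) c a - even_col (\<lambda>x. T (2 + x)) c (Suc a) = odd_col (Suc k) a - odd_col k a" for a
    proof -
      have "int (Suc k) - int (Suc a) = int k - int a" "- int (Suc k) - int (Suc a) = - int (Suc (Suc k)) - int a"
        by simp_all
      then show ?thesis
        by (simp only: even_col_def odd_col_def Suc) simp
    qed
    then have eq: "(\<lambda>a. even_col (\<lambda>x. T (2 + x)) c a - even_col (\<lambda>x. T (2 + x)) c (Suc a)) = (\<lambda>a. 1 * odd_col (Suc k) a + (- 1) * odd_col k a)"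
      by simp
    show ?thesis
      using lead_comb_add[OF lead_comb_single lead_comb_Suc[OF lead_comb_single], of odd_col k 1 "- 1"] Suc
      unfolding eq by simp
  qed
  ultimately have "lead_comb odd_col (b + 0) ((if b = 0 then 1 / 2 else 1) * (if b = 0 then 2 else 1))
      (\<lambda>a. h a (int b) - h (Suc a) (int b))"
    by (rule lead_comb_trans)
  then show ?thesis by (simp split: if_splits)
qed

text \<open>By \<open>p_rec\<close>, \<open>N\<close> sends \<open>(1 - z) z^(c-b)\<close> to
  \<open>q^(c-b+1) p (c-b+2)\<close>. So the factor \<open>1 - z\<close> of the difference becomes a
  shift by 2, and \<open>q powi (b - 1)\<close> removes the dependence on \<open>b\<close>.
  Induction on \<open>a\<close> replaces an explicit division.\<close>

lemma h_diff_lead: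
  "lead_comb (\<lambda>c b. p (2 + int c - b)) a (q ^ a) (\<lambda>b. q powi (b - 1) * (h a b - h (Suc a) b))"
proof (induction a)
  case 0
  have "h 0 b - h (Suc 0) b = q powi (1 - b) * p (2 - b)" for b
    using p_rec'[of "b - 1"] by (simp add: h_0 h_1)
  moreover have "q powi (b - 1) * q powi (1 - b) = 1" for b
    using q_nz by (simp flip: power_int_add)
  ultimately have "(\<lambda>b. q powi (b - 1) * (h 0 b - h (Suc 0) b)) = (\<lambda>b. 1 * p (2 + int 0 - b))"
    by (simp add: mult.assoc[symmetric])
  then show ?case
    using lead_comb_single[of "\<lambda>c b. p (2 + int c - b)" 0 1] by simp
next
  case (Suc a)
  let ?e = "\<lambda>c b. p (2 + int c - b)"
  \<comment> \<open>Up to \<open>q powi (b - 1)\<close>, this is the second difference of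
    \<open>h\<close> in the row index with negative sign; \<open>h_contiguous\<close> has eliminated
    the two outer rows.\<close>
  let ?g = "\<lambda>f b. (2 * q powi (b - 1)) * f b + (- (q powi (b - 1))) * f (b + 1)
    + (- ((q powi (b - 1)) * (1 - q powi (- b)))) * f (b - 1)"
  have "lead_comb (\<lambda>c. ?g (\<lambda>b. p (int c - b))) (Suc a) 1 (?g (h (Suc a)))"
    using lead_comb_op[OF h_lead[of "Suc a"], of "\<lambda>b. 2 * q powi (b - 1)" "\<lambda>b. b"
        "\<lambda>b. - (q powi (b - 1))" "\<lambda>b. b + 1"
        "\<lambda>b. - ((q powi (b - 1)) * (1 - q powi (- b)))" "\<lambda>b. b - 1"] by simp
  moreover have "lead_comb ?e (c + 0) (q ^ c) (?g (\<lambda>b. p (int c - b)))" for c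
  proof -
    \<comment> \<open>The second coefficient vanishes at \<open>c = 0\<close>, so no index below 0
      occurs.\<close>
    have eq: "?g (\<lambda>b. p (int c - b)) = (\<lambda>b. q ^ c * p (2 + int c - b) + (1 - q ^ c) / q * p (1 + int c - b))"
    proof
      fix b
      define u v where "u = q ^ c" and "v = q powi b"
      define P X Y where "P = p (int c - b)" and "X = p (int c - b + 1)" and "Y = p (int c - b + 2)"
      have i: "int c - (b + 1) = int c - b - 1" "int c - (b - 1) = int c - b + 1"
        "1 + int c - b = int c - b + 1" "2 + int c - b = int c - b + 2" by simp_all
      have uv: "u \<noteq> 0" "v \<noteq> 0" using q_nz by (auto simp: u_def v_def)
      have m: "p (int c - b - 1) = P + u / v * X"
        using p_rec[of "int c - b - 1"] q_nz by (simp add: u_def v_def P_def X_def power_int_diff add.commute)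
      have P: "P = X + q * u / v * Y"
        using p_rec[of "int c - b"] q_nz
        by (simp add: u_def v_def P_def X_def Y_def power_int_diff power_int_add mult_ac)
      have w: "q powi (b - 1) = v / q" "q powi (- b) = 1 / v"
        using q_nz by (simp_all add: v_def power_int_diff power_int_minus field_simps)
      have "2 * (v / q) * P + - (v / q) * (P + u / v * X) + - (v / q * (1 - 1 / v)) * X
          = u * Y + (1 - u) / q * X"
        unfolding P using uv q_nz by (simp add: field_simps)
      then show "?g (\<lambda>b. p (int c - b)) b = q ^ c * p (2 + int c - b) + (1 - q ^ c) / q * p (1 + int c - b)"
        unfolding i m w P_def[symmetric] X_def[symmetric] Y_def[symmetric] u_def[symmetric] .
    qed
    show ?thesis
    proof (cases c)
      case 0
      then show ?thesis
        unfolding eq using lead_comb_single[of ?e 0 1] by simp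
    next
      case (Suc k)
      have *: "1 + int (Suc k) - b = 2 + int k - b" for b
        by simp
      have eq': "?g (\<lambda>b. p (int c - b)) = (\<lambda>b. q ^ c * ?e (Suc k) b + (1 - q ^ c) / q * ?e k b)"
        unfolding eq unfolding Suc by (simp only: *)
      have "lead_comb ?e (Suc k) (q ^ c + 0) (\<lambda>b. q ^ c * ?e (Suc k) b + (1 - q ^ c) / q * ?e k b)"
        by (rule lead_comb_add[OF lead_comb_single[of ?e "Suc k" "q ^ c"]
              lead_comb_Suc[OF lead_comb_single[of ?e k "(1 - q ^ c) / q"]]])
      then show ?thesis
        unfolding eq' by (simp only: Suc add_0_right)
    qed
  qed
  ultimately have "lead_comb ?e (Suc a + 0) (1 * q ^ Suc a) (?g (h (Suc a)))"
    by (rule lead_comb_trans)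
  moreover have "(\<lambda>b. q powi (b - 1) * (h (Suc a) b - h (Suc (Suc a)) b)) =
      (\<lambda>b. q powi (b - 1) * (h a b - h (Suc a) b) + ?g (h (Suc a)) b)"
  proof
    fix b
    show "q powi (b - 1) * (h (Suc a) b - h (Suc (Suc a)) b) =
      q powi (b - 1) * (h a b - h (Suc a) b) + ?g (h (Suc a)) b"
      unfolding h_contiguous[of "Suc a" b] by (simp add: algebra_simps)
  qed
  ultimately show ?case
    using lead_comb_add[OF lead_comb_Suc[OF Suc.IH], of "1 * q ^ Suc a" "?g (h (Suc a))"]
    by (simp only: add_0_right add_0 mult_1)
qed

section \<open>Determinants of the theta columns\<close>

lemma det_even_col_integral:
  assumes "n \<ge> 1"
  shows "det (mat n n (\<lambda>(a, c). even_col (\<lambda>x. T (2 + x)) c a)) =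
    2 * det (mat n n (\<lambda>(a, b). p (int a - int b)))"
proof -
  have "det (mat n n (\<lambda>(a, b). h a (int b))) = det (mat n n (\<lambda>(a, b). p (int a - int b)))"
    using det_lead_comb[of n "\<lambda>c b. p (int c - b)" "\<lambda>_. 1" h int, OF h_lead]
    by (simp only: prod.neutral_const mult_1)
  moreover have "det (mat n n (\<lambda>(a, b). h a (int b))) =
      (\<Prod>b<n. if b = 0 then 1 / 2 else 1) * det (mat n n (\<lambda>(a, c). even_col (\<lambda>x. T (2 + x)) c a))"
    by (rule det_lead_comb_columns[of n _ "\<lambda>b. if b = 0 then 1 / 2 else 1" "\<lambda>b a. h a (int b)" "\<lambda>a. a"])
      (rule h_columns)
  moreover have "(\<Prod>b<n. if b = 0 then 1 / 2 else 1) = (1 / 2 :: complex)"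
    using prod_half[OF assms, of 1] by (simp only: power_one prod.neutral_const)
  ultimately show ?thesis
    by simp
qed

text \<open>The rows contribute \<open>s^(-a) q^a = s^a\<close> and the columns \<open>s^b\<close>,
  so these products cancel and only the factor 2 is left.\<close>

lemma det_even_col_half:
  assumes "n \<ge> 1"
  shows "det (mat n n (\<lambda>(a, c). even_col (\<lambda>x. s powi x * T (4 + x)) c a)) =
    2 * det (mat n n (\<lambda>(a, b). p (1 + int a - int b)))"
proof -
  let ?S = "\<Prod>a<n. s ^ a"
  have S: "?S \<noteq> 0"
    using s_nz by simp
  have "det (mat n n (\<lambda>(a, b). H_half b a)) =
      (\<Prod>a<n. s powi (- int a)) * det (mat n n (\<lambda>(a, b). H (a + 2) (int b - 1)))"
    unfolding H_half_def by (rule det_scale_rows)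
  also have "det (mat n n (\<lambda>(a, b). H (a + 2) (int b - 1))) =
      (\<Prod>a<n. q ^ a) * det (mat n n (\<lambda>(a, b). p (int a - (int b - 1))))"
    by (rule det_lead_comb[of n "\<lambda>c b. p (int c - b)" "\<lambda>a. q ^ a" "\<lambda>a. H (a + 2)" "\<lambda>b. int b - 1"])
      (rule H_lead)
  also have "(\<lambda>(a, b). p (int a - (int b - 1))) = (\<lambda>(a, b). p (1 + int a - int b))"
    by (simp add: algebra_simps)
  also have "(\<Prod>a<n. s powi (- int a)) * ((\<Prod>a<n. q ^ a) * d) = ?S * d" for d
  proof -
    have "s powi (- int a) * q ^ a = s ^ a" for a
      using s_nz by (simp add: s_sq[symmetric] power_int_minus power_mult_distrib power2_eq_square field_simps)
    then show ?thesis
      by (simp add: mult.assoc[symmetric] flip: prod.distrib)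
  qed
  finally have "det (mat n n (\<lambda>(a, b). H_half b a)) = ?S * det (mat n n (\<lambda>(a, b). p (1 + int a - int b)))" .
  moreover have "det (mat n n (\<lambda>(a, b). H_half b a)) =
      ?S / 2 * det (mat n n (\<lambda>(a, c). even_col (\<lambda>x. s powi x * T (4 + x)) c a))"
    unfolding prod_half[OF assms, of s, symmetric]
    by (rule det_lead_comb_columns[of n _ "\<lambda>b. if b = 0 then 1 / 2 else s ^ b" H_half "\<lambda>a. a"])
      (rule H_half_columns)
  ultimately show ?thesis
    using S by simp
qed

lemma det_odd_col:
  "det (mat n n (\<lambda>(a, c). odd_col c a)) = q ^ n * det (mat n n (\<lambda>(a, b). p (2 + int a - int b)))"
proof -
  let ?d = "\<lambda>a b. h a b - h (Suc a) b"
  have "det (mat n n (\<lambda>(a, b). ?d a (int b))) = (\<Prod>a<n. 1) * det (mat n n (\<lambda>(a, c). odd_col c a))"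
    by (rule det_lead_comb_columns[of n _ "\<lambda>_. 1" "\<lambda>b a. ?d a (int b)" "\<lambda>a. a"]) (rule h_diff_columns)
  then have "det (mat n n (\<lambda>(a, c). odd_col c a)) = det (mat n n (\<lambda>(a, b). ?d a (int b)))"
    by simp
  \<comment> \<open>Transposed, so that the factors depending on \<open>b\<close> become row
    factors.\<close>
  also have "\<dots> = det (mat n n (\<lambda>(b, a). q powi (1 - int b) * (q powi (int b - 1) * ?d a (int b))))"
    using q_nz det_mat_swap[of n "\<lambda>a b. ?d a (int b)"]
    by (simp add: mult.assoc[symmetric] flip: power_int_add)
  also have "\<dots> = (\<Prod>b<n. q powi (1 - int b)) * det (mat n n (\<lambda>(b, a). q powi (int b - 1) * ?d a (int b)))"
    by (rule det_scale_rows)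
  also have "det (mat n n (\<lambda>(b, a). q powi (int b - 1) * ?d a (int b))) =
      (\<Prod>a<n. q ^ a) * det (mat n n (\<lambda>(b, a). p (2 + int a - int b)))"
    by (rule det_lead_comb_columns[of n "\<lambda>c b. p (2 + int c - b)" "\<lambda>a. q ^ a"
      "\<lambda>a b. q powi (b - 1) * ?d a b" int]) (rule h_diff_lead)
  also have "det (mat n n (\<lambda>(b, a). p (2 + int a - int b))) = det (mat n n (\<lambda>(a, b). p (2 + int a - int b)))"
    by (rule det_mat_swap)
  also have "(\<Prod>b<n. q powi (1 - int b)) * ((\<Prod>a<n. q ^ a) * d) = q ^ n * d" for d
  proof -
    have "q powi (1 - int a) * q ^ a = q" for a
      using q_nz by (simp add: power_int_diff)
    then show ?thesis
      by (simp add: mult.assoc[symmetric] flip: prod.distrib)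
  qed
  finally show ?thesis .
qed

section \<open>Reduction of the theta entries of the theorem\<close>

text \<open>Apply \<open>T_shift\<close> \<open>a\<close> times. The power of \<open>s\<close> in
  front is exactly the one that leaves, besides \<open>s powi ((m - int a) * d)\<close>, a factor
  depending on the row alone. The two terms of an entry are \<open>m = j\<close> and
  \<open>m = - j\<close>.\<close>

lemma theta_row_shift:
  "s powi (m * (d + 2 * int a)) * T (2 * (d + 2 * int a) + 2 + m) =
    (- 1) ^ a * s powi (- (3 * int a ^ 2 - int a + 3 * d * int a))
      * (s powi ((m - int a) * d) * T (2 * d + 2 + (m - int a)))"
proof (induction a arbitrary: m)
  case 0
  then show ?case by simp
next
  case (Suc a)
  let ?x = "d + 2 * int a"
  have "T (2 * (d + 2 * int (Suc a)) + 2 + m) = - (q powi (- (2 * ?x + 2 + (m - 1)))) * T (2 * ?x + 2 + (m - 1))"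
    using T_shift[of "2 * ?x + 2 + (m - 1)"] by (simp add: algebra_simps)
  moreover have "s powi (m * (d + 2 * int (Suc a))) * q powi (- (2 * ?x + 2 + (m - 1))) =
      s powi (- (3 * ?x + 2)) * s powi ((m - 1) * ?x)"
    using s_nz by (simp add: q_powi algebra_simps flip: power_int_add)
  ultimately have "s powi (m * (d + 2 * int (Suc a))) * T (2 * (d + 2 * int (Suc a)) + 2 + m) =
      - (s powi (- (3 * ?x + 2))) * (s powi ((m - 1) * ?x) * T (2 * ?x + 2 + (m - 1)))"
    by (simp only: mult_minus_left mult_minus_right mult.assoc[symmetric])
  also have "\<dots> = - (s powi (- (3 * ?x + 2))) * ((- 1) ^ a * s powi (- (3 * int a ^ 2 - int a + 3 * d * int a))
      * (s powi ((m - 1 - int a) * d) * T (2 * d + 2 + (m - 1 - int a))))"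
    by (simp only: Suc.IH)
  also have "\<dots> = (- 1) ^ Suc a * (s powi (- (3 * ?x + 2)) * s powi (- (3 * int a ^ 2 - int a + 3 * d * int a)))
      * (s powi ((m - 1 - int a) * d) * T (2 * d + 2 + (m - 1 - int a)))"
    by simp
  also have "s powi (- (3 * ?x + 2)) * s powi (- (3 * int a ^ 2 - int a + 3 * d * int a)) =
      s powi (- (3 * int (Suc a) ^ 2 - int (Suc a) + 3 * d * int (Suc a)))"
    using s_nz by (simp add: power2_eq_square algebra_simps flip: power_int_add)
  also have "m - 1 - int a = m - int (Suc a)"
    by simp
  finally show ?case .
qed

text \<open>The same mechanism; here the two terms of an entry are \<open>m = j\<close> and
  \<open>m = - j - 1\<close>, which negate \<open>2 * m + 1\<close>.\<close>

lemma theta_row_shift_odd: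
  "s powi ((2 * m + 1) * int x) * T (4 * int x + 3 + m) =
    (- 1) ^ x * s powi (- (3 * int x ^ 2)) * T (3 + (m - int x))"
proof (induction x arbitrary: m)
  case 0
  then show ?case by simp
next
  case (Suc x)
  have "T (4 * int (Suc x) + 3 + m) = - (q powi (- (4 * int x + 3 + (m - 1)))) * T (4 * int x + 3 + (m - 1))"
    using T_shift[of "4 * int x + 3 + (m - 1)"] by (simp add: algebra_simps)
  moreover have "s powi ((2 * m + 1) * int (Suc x)) * q powi (- (4 * int x + 3 + (m - 1))) =
      s powi (- (6 * int x + 3)) * s powi ((2 * (m - 1) + 1) * int x)"
    using s_nz by (simp add: q_powi algebra_simps flip: power_int_add)
  ultimately have "s powi ((2 * m + 1) * int (Suc x)) * T (4 * int (Suc x) + 3 + m) =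
      - (s powi (- (6 * int x + 3))) * (s powi ((2 * (m - 1) + 1) * int x) * T (4 * int x + 3 + (m - 1)))"
    by (simp only: mult_minus_left mult_minus_right mult.assoc[symmetric])
  also have "\<dots> = - (s powi (- (6 * int x + 3))) * ((- 1) ^ x * s powi (- (3 * int x ^ 2)) * T (3 + (m - 1 - int x)))"
    by (simp only: Suc.IH)
  also have "\<dots> = (- 1) ^ Suc x * (s powi (- (6 * int x + 3)) * s powi (- (3 * int x ^ 2))) * T (3 + (m - 1 - int x))"
    by simp
  also have "s powi (- (6 * int x + 3)) * s powi (- (3 * int x ^ 2)) = s powi (- (3 * int (Suc x) ^ 2))"
    using s_nz by (simp add: power2_eq_square algebra_simps flip: power_int_add)
  also have "m - 1 - int x = m - int (Suc x)"
    by simp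
  finally show ?case .
qed

lemma prod_powi: "(\<Prod>a<n. s powi f a) = s powi (\<Sum>a<n. f a)" for n :: nat
  using s_nz by (induction n) (simp_all add: power_int_add)

lemma det_theta_even:
  assumes "det (mat n n (\<lambda>(a, c). even_col (\<lambda>x. s powi (x * d) * T (2 * d + 2 + x)) c a)) =
    2 * det (mat n n (\<lambda>(a, b). p (d + int a - int b)))"
  shows "2 * s powi (binom2 (int n) * (2 - 2 * int n - 3 * d)) * det_upto n (\<lambda>i j. p (d + i - j)) =
    det_upto n (\<lambda>i j.
      s powi ((j - 1) * (2 * int n - 2 * i + d)) * T (4 * int n + 2 * d + 1 - 4 * i + j)
      + s powi (- ((j - 1) * (2 * int n - 2 * i + d))) * T (4 * int n + 2 * d + 3 - 4 * i - j))"
    (is "_ = det_upto n ?R")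
proof -
  let ?e = "even_col (\<lambda>x. s powi (x * d) * T (2 * d + 2 + x))"
  define k where "k a = - (3 * int a ^ 2 - int a + 3 * d * int a)" for a
  have entry: "?R (int i + 1) (int j + 1) = (- 1) ^ (n - 1 - i) * s powi k (n - 1 - i) * ?e j (n - 1 - i)"
    if "i < n" for i j
  proof -
    \<comment> \<open>Rows are counted from the bottom, since the theta arguments decrease with
      \<open>i\<close>.\<close>
    define a where "a = n - 1 - i"
    have "int n = int i + 1 + int a"
      using that by (simp add: a_def)
    then have x: "(int j + 1 - 1) * (2 * int n - 2 * (int i + 1) + d) = int j * (d + 2 * int a)"
      "- (int j * (d + 2 * int a)) = - int j * (d + 2 * int a)"
      "4 * int n + 2 * d + 1 - 4 * (int i + 1) + (int j + 1) = 2 * (d + 2 * int a) + 2 + int j"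
      "4 * int n + 2 * d + 3 - 4 * (int i + 1) - (int j + 1) = 2 * (d + 2 * int a) + 2 + - int j"
      by (simp_all add: algebra_simps)
    show ?thesis
      unfolding x theta_row_shift a_def[symmetric] even_col_def k_def by (simp only: distrib_left)
  qed
  have "det_upto n ?R = det (mat n n (\<lambda>(i, j). (- 1) ^ (n - 1 - i) * s powi k (n - 1 - i) * ?e j (n - 1 - i)))"
    unfolding det_upto_def by (rule arg_cong[of _ _ det], rule eq_matI) (simp_all only: dim_row_mat dim_col_mat index_mat(1) prod.case entry)
  also have "\<dots> = (\<Prod>i<n. (- 1) ^ i) * det (mat n n (\<lambda>(a, c). (- 1) ^ a * s powi k a * ?e c a))"
    by (rule det_reverse_rows)
  also have "\<dots> = (\<Prod>i<n. (- 1) ^ i) * ((\<Prod>a<n. (- 1) ^ a * s powi k a) * det (mat n n (\<lambda>(a, c). ?e c a)))"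
    by (simp only: det_scale_rows)
  \<comment> \<open>The sign of the row reversal cancels the signs \<open>(- 1) ^ a\<close> of the
    rows.\<close>
  also have "\<dots> = s powi (\<Sum>a<n. k a) * det (mat n n (\<lambda>(a, c). ?e c a))"
    by (simp add: mult.assoc[symmetric] prod.distrib[symmetric] power_add[symmetric] prod_powi)
  also have "(\<Sum>a<n. k a) = binom2 (int n) * (2 - 2 * int n - 3 * d)"
    unfolding k_def by (rule sum_exponent_even)
  also have "det (mat n n (\<lambda>(a, c). ?e c a)) = 2 * det_upto n (\<lambda>i j. p (d + i - j))"
    by (simp only: assms det_upto_shift)
  finally show ?thesis
    by (simp only: mult_ac)
qed

lemma det_theta_odd:
  "(- 1) ^ n * s powi (- (int n * (2 * (int n) ^ 2 + 3 * int n - 3) div 2)) * det_upto n (\<lambda>i j. p (2 + i - j)) =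
    det_upto n (\<lambda>i j.
      s powi ((2 * j - 1) * (int n - i + 1)) * T (6 + 4 * int n - 4 * i + j)
      - s powi (- ((2 * j - 1) * (int n - i + 1))) * T (7 + 4 * int n - 4 * i - j))"
    (is "_ = det_upto n ?R")
proof -
  define k where "k a = - (3 * int (Suc a) ^ 2)" for a
  have entry: "?R (int i + 1) (int j + 1) = (- 1) ^ Suc (n - 1 - i) * s powi k (n - 1 - i) * odd_col j (n - 1 - i)"
    if "i < n" for i j
  proof -
    define a where "a = n - 1 - i"
    have "int n = int i + int (Suc a)"
      using that by (simp add: a_def)
    then have x: "(2 * (int j + 1) - 1) * (int n - (int i + 1) + 1) = (2 * int j + 1) * int (Suc a)"
      "- ((2 * int j + 1) * int (Suc a)) = (2 * (- int (Suc j)) + 1) * int (Suc a)"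
      "6 + 4 * int n - 4 * (int i + 1) + (int j + 1) = 4 * int (Suc a) + 3 + int j"
      "7 + 4 * int n - 4 * (int i + 1) - (int j + 1) = 4 * int (Suc a) + 3 + - int (Suc j)"
      by (simp_all add: algebra_simps)
    have y: "2 + (int j - int a) = 3 + (int j - int (Suc a))"
      "2 + (- int (Suc j) - int a) = 3 + (- int (Suc j) - int (Suc a))"
      by simp_all
    show ?thesis
      unfolding x theta_row_shift_odd a_def[symmetric] odd_col_def y k_def by (simp only: right_diff_distrib)
  qed
  have "det_upto n ?R = det (mat n n (\<lambda>(i, j). (- 1) ^ Suc (n - 1 - i) * s powi k (n - 1 - i) * odd_col j (n - 1 - i)))"
    unfolding det_upto_def by (rule arg_cong[of _ _ det], rule eq_matI) (simp_all only: dim_row_mat dim_col_mat index_mat(1) prod.case entry)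
  also have "\<dots> = (\<Prod>i<n. (- 1) ^ i) * det (mat n n (\<lambda>(a, c). (- 1) ^ Suc a * s powi k a * odd_col c a))"
    by (rule det_reverse_rows)
  also have "\<dots> = (\<Prod>i<n. (- 1) ^ i) * ((\<Prod>a<n. (- 1) ^ Suc a * s powi k a) * det (mat n n (\<lambda>(a, c). odd_col c a)))"
    by (simp only: det_scale_rows)
  \<comment> \<open>Each row now carries one more sign than the reversal cancels.\<close>
  also have "\<dots> = (- 1) ^ n * s powi (\<Sum>a<n. k a) * det (mat n n (\<lambda>(a, c). odd_col c a))"
  proof -
    have "(\<Prod>i<n. (- 1) ^ i) * (\<Prod>a<n. (- 1) ^ Suc a * s powi k a) =
        (\<Prod>a<n. (- 1) * ((- 1) ^ a * (- 1) ^ a) * s powi k a)"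
      by (simp only: prod.distrib[symmetric] power_Suc mult_ac)
    also have "\<dots> = (- 1) ^ n * s powi (\<Sum>a<n. k a)"
      by (simp only: prod.distrib prod_constant card_lessThan prod_powi)
        (simp add: prod.distrib[symmetric] power_add[symmetric])
    finally show ?thesis
      by (simp only: mult.assoc[symmetric])
  qed
  also have "det (mat n n (\<lambda>(a, c). odd_col c a)) = s powi (2 * int n) * det_upto n (\<lambda>i j. p (2 + i - j))"
    by (simp add: det_odd_col det_upto_shift q_powi flip: power_int_of_nat)
  also have "(- 1) ^ n * s powi (\<Sum>a<n. k a) * (s powi (2 * int n) * D) =
      (- 1) ^ n * s powi ((\<Sum>a<n. k a) + 2 * int n) * D" for D
    using s_nz by (simp add: power_int_add)
  also have "(\<Sum>a<n. k a) + 2 * int n = - (int n * (2 * (int n) ^ 2 + 3 * int n - 3) div 2)"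
    unfolding k_def by (rule sum_exponent_odd)
  finally show ?thesis ..
qed

end

theorem mainTheorem8:
  fixes n :: nat and q s :: complex
  assumes "n \<ge> 1"
    and "0 < norm q" and "norm q < 1"
    and "s ^ 2 = q"
  shows "(\<forall>\<delta>\<in>{0, 1 :: int}.
            2 * s powi (binom2 (int n) * (2 - 2 * int n - 3 * \<delta>))
              * det_upto n (\<lambda>i j. schur_pi q (\<delta> + i - j))
            = det_upto n (\<lambda>i j.
                s powi ((j - 1) * (2 * int n - 2 * i + \<delta>))
                  * qtheta (q powi (4 * int n + 2 * \<delta> + 1 - 4 * i + j)) (q ^ 5)
                + s powi (- ((j - 1) * (2 * int n - 2 * i + \<delta>)))
                  * qtheta (q powi (4 * int n + 2 * \<delta> + 3 - 4 * i - j)) (q ^ 5)))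
       \<and> (-1) ^ n * s powi (- (int n * (2 * (int n) ^ 2 + 3 * int n - 3) div 2))
            * det_upto n (\<lambda>i j. schur_pi q (2 + i - j))
         = det_upto n (\<lambda>i j.
             s powi ((2 * j - 1) * (int n - i + 1))
               * qtheta (q powi (6 + 4 * int n - 4 * i + j)) (q ^ 5)
             - s powi (- ((2 * j - 1) * (int n - i + 1)))
               * qtheta (q powi (7 + 4 * int n - 4 * i - j)) (q ^ 5))"
proof -
  have q: "q \<noteq> 0" and q5: "norm (q ^ 5) < 1" "q ^ 5 \<noteq> 0"
    using assms(2,3) by (auto simp: norm_power power_less_one_iff)
  interpret schur_system q s "schur_pi q" "\<lambda>a. qtheta (q powi a) (q ^ 5)"
  proof
    show "q \<noteq> 0" "s\<^sup>2 = q" by fact+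
    show "schur_pi q k = schur_pi q (k + 1) + q powi (k + 1) * schur_pi q (k + 2)" for k
      using q by (rule schur_pi_rec)
    show "qtheta (q powi (a + 5)) (q ^ 5) = - (q powi (- a)) * qtheta (q powi a) (q ^ 5)" for a
      using qtheta_shift[OF q5, of "q powi a"] q by (simp add: power_int_add power_int_minus field_simps)
    show "qtheta (q powi (5 - a)) (q ^ 5) = qtheta (q powi a) (q ^ 5)" for a
      using qtheta_reflect[OF q5(2), of "q powi a"] q by (simp add: power_int_diff)
    show "qtheta (q powi 1) (q ^ 5) = schur_pi q 1" "qtheta (q powi 2) (q ^ 5) = schur_pi q 0"
      using q by (simp_all add: schur_pi_0_1)
  qed
  show ?thesis
  proof (intro conjI ballI)
    fix \<delta> :: int
    assume "\<delta> \<in> {0, 1}"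
    then show "2 * s powi (binom2 (int n) * (2 - 2 * int n - 3 * \<delta>))
        * det_upto n (\<lambda>i j. schur_pi q (\<delta> + i - j))
      = det_upto n (\<lambda>i j.
          s powi ((j - 1) * (2 * int n - 2 * i + \<delta>))
            * qtheta (q powi (4 * int n + 2 * \<delta> + 1 - 4 * i + j)) (q ^ 5)
          + s powi (- ((j - 1) * (2 * int n - 2 * i + \<delta>)))
            * qtheta (q powi (4 * int n + 2 * \<delta> + 3 - 4 * i - j)) (q ^ 5))"
      \<comment> \<open>The premise is the integral determinant for \<open>\<delta> = 0\<close> and
        the half-integral one for \<open>\<delta> = 1\<close>.\<close>
      using det_theta_even[where d = \<delta> and n = n] det_even_col_integral[OF assms(1)] det_even_col_half[OF assms(1)]
      by (elim insertE emptyE) simp_all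
  qed (rule det_theta_odd)
qed

end
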